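(* Let $n,d$ be positive integers with $n\le d+1$, let $\bar D$ be the Euclidean distance matrix of a configuration in $\mathbb{R}^{n\times d}$, and let $f(P)=\frac12\|\mathcal K(PP^T)-\bar D\|_F^2$ for $P\in\mathbb{R}^{n\times d}$. If $P\in\mathbb{R}^{n\times d}$ is a stationary point of $f$ satisfying the second-order necessary optimality conditions, that is, $f'(P)=0$ and $f''(P)(\Delta P,\Delta P)\ge 0$ for all $\Delta P\in\mathbb{R}^{n\times d}$, then $P$ is a global minimizer of $f$ over $\mathbb{R}^{n\times d}$.
   Context: $e$ is the all-ones vector in $\mathbb{R}^n$, $\|\cdot\|_F$ is the Frobenius norm, $\mathbb{S}^n$ is the space of real symmetric $n\times n$ matrices. The operator $\mathcal K:\mathbb{S}^n\to\mathbb{S}^n$ is $\mathcal K(G)=\operatorname{diag}(G)e^T+e\operatorname{diag}(G)^T-2G$, where $\operatorname{diag}(G)\in\mathbb{R}^n$ is the vector of diagonal entries. For $P\in\mathbb{R}^{n\times d}$ with rows $p_1^T,\dots,p_n^T$, $\mathcal D(P)=\mathcal K(PP^T)=(\|p_i-p_j\|^2)_{ij}$ is its Euclidean distance matrix. $\bar D=\mathcal D(\bar P)$ for some fixed $\bar P\in\mathbb{R}^{n\times d}$ with $\bar P^Te=0$. $f'$ and $f''$ denote the first and second Fréchet derivatives. *)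

theory Defs
  imports "HOL-Analysis.Analysis"
begin

text \<open>
  Matrices in $\mathbb{R}^{n \times d}$ have type \<^typ>\<open>real ^ 'd ^ 'n\<close>, so that \<open>P $ i\<close> is the
  $i$-th row (the point $p_i$), \<open>n = CARD('n)\<close> and \<open>d = CARD('d)\<close>.
\<close>

definition diag_vec :: "real ^ 'n ^ 'n \<Rightarrow> real ^ 'n" where
  "diag_vec G = (\<chi> i. G $ i $ i)"

definition outer_prod :: "real ^ 'n \<Rightarrow> real ^ 'm \<Rightarrow> real ^ 'm ^ 'n" where
  "outer_prod u v = (\<chi> i j. u $ i * v $ j)"

text \<open>
  The operator $\mathcal{K}(G) = \mathrm{diag}(G) e^T + e\, \mathrm{diag}(G)^T - 2G$; the vector
  \<open>1\<close> is the all-ones vector $e$. It is given on all square matrices, but is only applied to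
  symmetric ones below.
\<close>

definition lindenstrauss :: "real ^ 'n ^ 'n \<Rightarrow> real ^ 'n ^ 'n" where
  "lindenstrauss G = outer_prod (diag_vec G) 1 + outer_prod 1 (diag_vec G) - 2 *\<^sub>R G"

definition edm :: "real ^ 'd ^ 'n \<Rightarrow> real ^ 'n ^ 'n" where
  "edm P = lindenstrauss (P ** transpose P)"

lemma edm_nth: "edm P $ i $ j = (norm (P $ i - P $ j))\<^sup>2"
proof -
  have "(P ** transpose P) $ k $ l = P $ k \<bullet> P $ l" for k l
    by (simp add: matrix_matrix_mult_def transpose_def inner_vec_def)
  then show ?thesis
    by (simp add: edm_def lindenstrauss_def outer_prod_def diag_vec_def power2_norm_eq_inner
        inner_diff_left inner_diff_right inner_commute)
qed

text \<open>The norm of the type \<^typ>\<open>real ^ 'n ^ 'm\<close> is the Frobenius norm.\<close>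

lemma norm_matrix_eq_frobenius:
  fixes A :: "real ^ 'n ^ 'm"
  shows "norm A = sqrt (\<Sum>i\<in>UNIV. \<Sum>j\<in>UNIV. (A $ i $ j)\<^sup>2)"
  by (simp add: norm_eq_sqrt_inner inner_vec_def power2_eq_square)

definition stress :: "real ^ 'n ^ 'n \<Rightarrow> real ^ 'd ^ 'n \<Rightarrow> real" where
  "stress Dbar P = 1 / 2 * (norm (lindenstrauss (P ** transpose P) - Dbar))\<^sup>2"

text \<open>
  Frechet derivatives as bounded linear maps, so that the second derivative is the derivative of
  the map $x \mapsto f'(x)$ with respect to the operator norm. As with \<^const>\<open>frechet_derivative\<close>,
  the values are meaningful only where the respective map is differentiable; \<^const>\<open>stress\<close> is a
  polynomial in the matrix entries, hence smooth everywhere.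
\<close>

definition frechet1 ::
  "('a::real_normed_vector \<Rightarrow> 'b::real_normed_vector) \<Rightarrow> 'a \<Rightarrow> ('a \<Rightarrow>\<^sub>L 'b)" where
  "frechet1 f x = Blinfun (frechet_derivative f (at x))"

definition frechet2 ::
  "('a::real_normed_vector \<Rightarrow> 'b::real_normed_vector) \<Rightarrow> 'a \<Rightarrow> ('a \<Rightarrow>\<^sub>L 'a \<Rightarrow>\<^sub>L 'b)" where
  "frechet2 f x = frechet1 (frechet1 f) x"

end

theory Submission
  imports Defs
begin

text \<open>
  Write \<open>w i j = \<parallel>p\<^sub>i - p\<^sub>j\<parallel>\<^sup>2 - D i j\<close> for the residuals at \<open>P\<close>. The stress is half the sum of
  their squares, and the squared distances are quadratic in \<open>P\<close>, so the first derivative in direction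
  \<open>X\<close> is \<open>2 \<Sum> w i j (p\<^sub>i - p\<^sub>j) \<bullet> (x\<^sub>i - x\<^sub>j)\<close>, and the second derivative at \<open>(X, X)\<close> is
  \<open>\<Sum> (2 w i j \<parallel>x\<^sub>i - x\<^sub>j\<parallel>\<^sup>2 + 4 ((p\<^sub>i - p\<^sub>j) \<bullet> (x\<^sub>i - x\<^sub>j))\<^sup>2)\<close>.

  Everything reduces to the claim that the residual form \<open>\<phi>(u) = \<Sum> w i j (u\<^sub>i - u\<^sub>j)\<^sup>2\<close> is nonnegative
  on vectors \<open>u\<close> (lemma \<open>residual_form_nonneg\<close>). Given the claim, summing over the coordinates of a
  configuration \<open>Q\<close> gives \<open>\<Sum> w i j \<parallel>q\<^sub>i - q\<^sub>j\<parallel>\<^sup>2 \<ge> 0\<close>, while stationarity in direction \<open>P\<close> gives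
  \<open>\<Sum> w i j \<parallel>p\<^sub>i - p\<^sub>j\<parallel>\<^sup>2 = 0\<close>. The stress is a convex function of the distance matrix, so it lies above
  its linearization at \<open>P\<close>, and the stress at \<open>Q\<close> exceeds that at \<open>P\<close> by at least the difference
  of these two sums.

  For the claim, rank-one directions with rows \<open>x\<^sub>i = u\<^sub>i v\<close> suffice, and there are two cases. If some
  \<open>v \<noteq> 0\<close> is orthogonal to all differences \<open>p\<^sub>i - p\<^sub>j\<close>, moving the points along \<open>v\<close> changes the
  squared distances only to second order, so the second derivative is \<open>2 \<parallel>v\<parallel>\<^sup>2 \<phi>(u)\<close>. Otherwise the \<open>n \<le> d + 1\<close>
  points span all of \<open>\<real>\<^sup>d\<close> affinely and hence form a simplex, so that \<open>u\<close> is the restriction to the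
  points of an affine function \<open>p \<mapsto> p \<bullet> v + c\<close> (lemma \<open>affine_functions_exhaust\<close>); with this \<open>v\<close>
  the first derivative is \<open>2 \<phi>(u)\<close>, and \<open>\<phi>(u) = 0\<close>.
\<close>

section \<open>Stress and its derivatives as sums over pairs of points\<close>

lemma stress_sum:
  "stress D P = (\<Sum>i\<in>UNIV. \<Sum>j\<in>UNIV. ((norm (P $ i - P $ j))\<^sup>2 - D $ i $ j)\<^sup>2) / 2"
proof -
  have "stress D P = (norm (edm P - D))\<^sup>2 / 2"
    by (simp add: stress_def edm_def)
  also have "\<dots> = (\<Sum>i\<in>UNIV. \<Sum>j\<in>UNIV. ((norm (P $ i - P $ j))\<^sup>2 - D $ i $ j)\<^sup>2) / 2"
    by (simp add: norm_matrix_eq_frobenius edm_nth sum_nonneg)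
  finally show ?thesis .
qed

lemma frechet1_eqI:
  assumes "(f has_derivative blinfun_apply F) (at x)"
  shows "frechet1 f x = F"
  by (simp add: frechet1_def blinfun_apply_inverse flip: frechet_derivative_at[OF assms])

definition point_diff :: "'n \<Rightarrow> 'n \<Rightarrow> (real ^ 'd ^ 'n) \<Rightarrow>\<^sub>L (real ^ 'd)" where
  "point_diff i j = Blinfun (\<lambda>X. X $ i - X $ j)"

lemma point_diff_apply [simp]:
  fixes X :: "real ^ 'd ^ 'n"
  shows "blinfun_apply (point_diff i j) X = X $ i - X $ j"
proof -
  have "bounded_linear (\<lambda>X :: real ^ 'd ^ 'n. X $ i - X $ j)"
    by (intro bounded_linear_sub bounded_linear_vec_nth)
  then show ?thesis
    by (simp add: point_diff_def bounded_linear_Blinfun_apply)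
qed

text \<open>
  Half the derivative of the squared distance between the points \<open>i\<close> and \<open>j\<close>. It is kept as an operator
  that depends linearly on \<open>P\<close>, so that the gradient of the stress can itself be differentiated in
  the operator norm by the usual product and sum rules.
\<close>

definition pair_form :: "'n \<Rightarrow> 'n \<Rightarrow> real ^ 'd ^ 'n \<Rightarrow> (real ^ 'd ^ 'n) \<Rightarrow>\<^sub>L real" where
  "pair_form i j P = blinfun_inner_left (P $ i - P $ j) o\<^sub>L point_diff i j"

lemma pair_form_apply [simp]:
  "blinfun_apply (pair_form i j P) X = (P $ i - P $ j) \<bullet> (X $ i - X $ j)"
  by (simp add: pair_form_def inner_commute)

lemma bounded_linear_pair_form:
  "bounded_linear (pair_form i j :: real ^ 'd ^ 'n \<Rightarrow> _)"
proof -
  have "bounded_linear (\<lambda>P :: real ^ 'd ^ 'n. blinfun_inner_left (P $ i - P $ j))"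
    by (intro bounded_linear_compose[OF bounded_linear_blinfun_inner_left]
        bounded_linear_sub bounded_linear_vec_nth)
  then show ?thesis
    unfolding pair_form_def
    by (rule bounded_bilinear.bounded_linear_left[OF bounded_bilinear_blinfun_compose,
          THEN bounded_linear_compose])
qed

definition stress_grad :: "real ^ 'n ^ 'n \<Rightarrow> real ^ 'd ^ 'n \<Rightarrow> (real ^ 'd ^ 'n) \<Rightarrow>\<^sub>L real" where
  "stress_grad D P =
    (\<Sum>i\<in>UNIV. \<Sum>j\<in>UNIV. (2 * ((norm (P $ i - P $ j))\<^sup>2 - D $ i $ j)) *\<^sub>R pair_form i j P)"

lemma stress_grad_apply:
  "blinfun_apply (stress_grad D P) X = 
    2 * (\<Sum>i\<in>UNIV. \<Sum>j\<in>UNIV. ((norm (P $ i - P $ j))\<^sup>2 - D $ i $ j) *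
      ((P $ i - P $ j) \<bullet> (X $ i - X $ j)))"
  by (simp add: stress_grad_def blinfun.sum_left blinfun.scaleR_left sum_distrib_left mult.assoc
      del: right_diff_distrib_numeral)

lemma has_derivative_sqnorm_diff:
  "((\<lambda>P :: real ^ 'd ^ 'n. (norm (P $ i - P $ j))\<^sup>2) has_derivative
     (\<lambda>X. 2 * ((P $ i - P $ j) \<bullet> (X $ i - X $ j)))) (at P)"
  unfolding power2_norm_eq_inner
  by (auto intro!: derivative_eq_intros bounded_linear.has_derivative[OF bounded_linear_vec_nth]
      simp: inner_commute)

lemma has_derivative_stress: 
  "(stress D has_derivative blinfun_apply (stress_grad D P)) (at P)"
proof -
  have summand: "((\<lambda>P. ((norm (P $ i - P $ j))\<^sup>2 - D $ i $ j)\<^sup>2) has_derivative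
      (\<lambda>X. 2 * (2 * (((norm (P $ i - P $ j))\<^sup>2 - D $ i $ j) *
        ((P $ i - P $ j) \<bullet> (X $ i - X $ j)))))) (at P)" for i j
    by (rule derivative_eq_intros has_derivative_sqnorm_diff refl)+ (simp add: fun_eq_iff)
  have "((\<lambda>P. 1 / 2 * (\<Sum>i\<in>UNIV. \<Sum>j\<in>UNIV. ((norm (P $ i - P $ j))\<^sup>2 - D $ i $ j)\<^sup>2))
    has_derivative blinfun_apply (stress_grad D P)) (at P)"
    by (rule has_derivative_eq_rhs[OF has_derivative_mult_right[OF has_derivative_sum[OF
            has_derivative_sum[OF summand]]]])
      (simp add: fun_eq_iff stress_grad_apply flip: sum_distrib_left)
  then show ?thesis
    by (simp add: stress_sum[abs_def])
qed

lemma frechet1_stress: "frechet1 (stress D) = stress_grad D"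
  by (rule ext) (rule frechet1_eqI[OF has_derivative_stress])

definition stress_hess ::
  "real ^ 'n ^ 'n \<Rightarrow> real ^ 'd ^ 'n \<Rightarrow> (real ^ 'd ^ 'n) \<Rightarrow> (real ^ 'd ^ 'n) \<Rightarrow>\<^sub>L real" where
  "stress_hess D P X =
    (\<Sum>i\<in>UNIV. \<Sum>j\<in>UNIV. (2 * ((norm (P $ i - P $ j))\<^sup>2 - D $ i $ j)) *\<^sub>R pair_form i j X
       + (4 * ((P $ i - P $ j) \<bullet> (X $ i - X $ j))) *\<^sub>R pair_form i j P)"

lemma has_derivative_stress_grad: "(stress_grad D has_derivative stress_hess D P) (at P)"
  unfolding stress_grad_def[abs_def] stress_hess_def[abs_def]
  by (rule derivative_eq_intros has_derivative_sqnorm_diff refl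
      bounded_linear.has_derivative[OF bounded_linear_pair_form])+ simp

lemma frechet2_stress_diagonal:
  "blinfun_apply (blinfun_apply (frechet2 (stress D) P) X) X =
    (\<Sum>i\<in>UNIV. \<Sum>j\<in>UNIV. 2 * ((norm (P $ i - P $ j))\<^sup>2 - D $ i $ j) * (norm (X $ i - X $ j))\<^sup>2
      + 4 * ((P $ i - P $ j) \<bullet> (X $ i - X $ j))\<^sup>2)"
proof -
  have "blinfun_apply (Blinfun (stress_hess D P)) = stress_hess D P"
    using has_derivative_bounded_linear[OF has_derivative_stress_grad]
    by (rule bounded_linear_Blinfun_apply)
  then have "blinfun_apply (frechet2 (stress D) P) = stress_hess D P"
    using frechet1_eqI[of "stress_grad D" "Blinfun (stress_hess D P)" P]
    by (simp add: frechet2_def frechet1_stress has_derivative_stress_grad)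
  then show ?thesis
    by (simp add: stress_hess_def blinfun.sum_left blinfun.scaleR_left blinfun.add_left
        dot_square_norm power2_eq_square mult.assoc
        del: right_diff_distrib_numeral)
qed

section \<open>Configurations that span all directions\<close>

text \<open>
  The map sending \<open>(v, c)\<close> to the values of \<open>p \<mapsto> p \<bullet> v + c\<close> at the points is injective: if all
  values vanish, then \<open>v\<close> is orthogonal to all differences of points, hence \<open>v = 0\<close>, and then
  \<open>c = 0\<close>. Its domain has dimension \<open>d + 1 \<ge> n\<close>, so it is onto.
\<close>

lemma affine_functions_exhaust:
  fixes P :: "real ^ 'd ^ 'n" and u :: "real ^ 'n"
  assumes dims: "CARD('n) \<le> CARD('d) + 1"
    and span: "\<And>v. (\<And>i j. (P $ i - P $ j) \<bullet> v = 0) \<Longrightarrow> v = 0"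
  obtains v c where "\<And>i. u $ i = P $ i \<bullet> v + c"
proof -
  define L :: "(real ^ 'd) \<times> real \<Rightarrow> real ^ 'n" where "L = (\<lambda>(v, c). \<chi> i. P $ i \<bullet> v + c)"
  have lin: "linear L"
    by (rule linearI) (auto simp: L_def vec_eq_iff inner_add_right algebra_simps)
  have "x = 0" if "L x = 0" for x
  proof -
    obtain v c where x: "x = (v, c)"
      by fastforce
    have z: "P $ i \<bullet> v = - c" for i
      using that by (simp add: L_def x vec_eq_iff eq_neg_iff_add_eq_0)
    then have "v = 0"
      by (intro span) (simp add: inner_diff_left)
    with z show "x = 0"
      by (simp add: x zero_prod_def)
  qed
  then have inj: "inj L"
    using linear_injective_0[OF lin] by blast
  have "dim (range L) = CARD('d) + 1"
    using dim_image_eq[OF lin, of UNIV] inj by simp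
  then have "range L = UNIV"
    using dim_eq_full[of "range L"] dim_subset_UNIV[of "range L"] dims
    by (simp add: span_eq_iff[THEN iffD2] linear_subspace_image[OF lin])
  then obtain x where "u = L x"
    by blast
  then show ?thesis
    by (intro that[of "fst x" "snd x"]) (simp add: L_def case_prod_beta)
qed

section \<open>Second-order stationary points\<close>

text \<open>
  This form is \<open>u \<bullet> S u\<close> for the Laplacian-type matrix \<open>S\<close> obtained by applying the adjoint of
  \<open>\<K>\<close> to the residual matrix. The lemma says that \<open>S\<close> is positive semidefinite, which is the dual
  feasibility condition of the convex problem over positive semidefinite Gram matrices.
\<close>

lemma residual_form_nonneg:
  fixes P :: "real ^ 'd ^ 'n" and u :: "real ^ 'n"
  assumes dims: "CARD('n) \<le> CARD('d) + 1"
    and first_order: "frechet1 (stress D) P = 0"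
    and second_order: "\<And>X. blinfun_apply (blinfun_apply (frechet2 (stress D) P) X) X \<ge> 0"
  shows "(\<Sum>i\<in>UNIV. \<Sum>j\<in>UNIV. ((norm (P $ i - P $ j))\<^sup>2 - D $ i $ j) * (u $ i - u $ j)\<^sup>2) \<ge> 0"
    (is "?q \<ge> 0")
proof (cases "\<exists>v. v \<noteq> 0 \<and> (\<forall>i j. (P $ i - P $ j) \<bullet> v = 0)")
  case True
  then obtain v where v: "v \<noteq> 0" "\<And>i j. (P $ i - P $ j) \<bullet> v = 0"
    by blast
  define X :: "real ^ 'd ^ 'n" where "X = (\<chi> i. u $ i *\<^sub>R v)"
  have X: "X $ i - X $ j = (u $ i - u $ j) *\<^sub>R v" for i j
    by (simp add: X_def scaleR_left_diff_distrib)
  \<comment> \<open>The nonnegative squares in the second derivative vanish, as \<open>v\<close> is orthogonal to the differences.\<close>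
  have "blinfun_apply (blinfun_apply (frechet2 (stress D) P) X) X = 2 * (norm v)\<^sup>2 * ?q"
    by (simp add: frechet2_stress_diagonal X v power_mult_distrib sum_distrib_left mult_ac
        del: right_diff_distrib_numeral)
  then show ?thesis
    using second_order[of X] v(1) by (simp add: zero_le_mult_iff)
next
  case False
  then obtain v c where u: "\<And>i. u $ i = P $ i \<bullet> v + c"
    using affine_functions_exhaust[OF dims, of P u] by metis
  define X :: "real ^ 'd ^ 'n" where "X = (\<chi> i. u $ i *\<^sub>R v)"
  \<comment> \<open>The vector \<open>v\<close> serves twice: as slope of \<open>u\<close> over the points and as direction of motion.\<close>
  have "(P $ i - P $ j) \<bullet> (X $ i - X $ j) = (u $ i - u $ j)\<^sup>2" for i j
    by (simp add: X_def u inner_diff_left power2_eq_square flip: scaleR_left_diff_distrib)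
  then have "blinfun_apply (stress_grad D P) X = 2 * ?q"
    by (simp add: stress_grad_apply)
  then show ?thesis
    using first_order by (simp add: frechet1_stress)
qed

theorem theorem4p10:
  fixes Dbar :: "real ^ 'n ^ 'n" and Pbar P :: "real ^ 'd ^ 'n"
  assumes dims: "CARD('n) \<le> CARD('d) + 1"
    and Dbar: "Dbar = edm Pbar"
    and first_order: "frechet1 (stress Dbar) P = 0"
    and second_order: "\<forall>\<Delta>P :: real ^ 'd ^ 'n. 
          blinfun_apply (blinfun_apply (frechet2 (stress Dbar) P) \<Delta>P) \<Delta>P \<ge> 0"
  shows "\<forall>Q :: real ^ 'd ^ 'n. stress Dbar P \<le> stress Dbar Q"
proof
  fix Q :: "real ^ 'd ^ 'n"
  define w where "w i j = (norm (P $ i - P $ j))\<^sup>2 - Dbar $ i $ j" for i j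
  \<comment> \<open>Stationarity in the direction \<open>P\<close> itself, that is, under scaling of the configuration.\<close>
  have P0: "(\<Sum>i\<in>UNIV. \<Sum>j\<in>UNIV. w i j * (norm (P $ i - P $ j))\<^sup>2) = 0"
    using arg_cong[OF first_order, of "\<lambda>F. blinfun_apply F P"]
    by (simp add: frechet1_stress stress_grad_apply w_def power2_norm_eq_inner)
  have "(\<Sum>i\<in>UNIV. \<Sum>j\<in>UNIV. w i j * (norm (Q $ i - Q $ j))\<^sup>2)
      = (\<Sum>i\<in>UNIV. \<Sum>j\<in>UNIV. \<Sum>k\<in>UNIV. w i j * (Q $ i $ k - Q $ j $ k)\<^sup>2)"
    unfolding power2_norm_eq_inner inner_vec_def
    by (simp add: sum_distrib_left power2_eq_square)
  also have "\<dots> = (\<Sum>i\<in>UNIV. \<Sum>k\<in>UNIV. \<Sum>j\<in>UNIV. w i j * (Q $ i $ k - Q $ j $ k)\<^sup>2)"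
    by (intro sum.cong refl sum.swap)
  also have "\<dots> = (\<Sum>k\<in>UNIV. \<Sum>i\<in>UNIV. \<Sum>j\<in>UNIV. w i j * (Q $ i $ k - Q $ j $ k)\<^sup>2)"
    by (rule sum.swap)
  also have "\<dots> \<ge> 0"
    using residual_form_nonneg[OF dims first_order, of "\<chi> i. Q $ i $ k" for k] second_order
    by - (rule sum_nonneg, simp add: w_def)
  finally have Q0: "(\<Sum>i\<in>UNIV. \<Sum>j\<in>UNIV. w i j * (norm (Q $ i - Q $ j))\<^sup>2) \<ge> 0" .
  have "(\<Sum>i\<in>UNIV. \<Sum>j\<in>UNIV. (w i j)\<^sup>2)
      \<le> (\<Sum>i\<in>UNIV. \<Sum>j\<in>UNIV. (w i j)\<^sup>2)
        + 2 * (\<Sum>i\<in>UNIV. \<Sum>j\<in>UNIV. w i j * (norm (Q $ i - Q $ j))\<^sup>2)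
        - 2 * (\<Sum>i\<in>UNIV. \<Sum>j\<in>UNIV. w i j * (norm (P $ i - P $ j))\<^sup>2)"
    using Q0 P0 by simp
  also have "\<dots> = (\<Sum>i\<in>UNIV. \<Sum>j\<in>UNIV. (w i j)\<^sup>2
        + 2 * w i j * ((norm (Q $ i - Q $ j))\<^sup>2 - (norm (P $ i - P $ j))\<^sup>2))"
    by (simp add: sum.distrib sum_subtractf sum_distrib_left algebra_simps)
  also have "\<dots> \<le> (\<Sum>i\<in>UNIV. \<Sum>j\<in>UNIV. ((norm (Q $ i - Q $ j))\<^sup>2 - Dbar $ i $ j)\<^sup>2)"
  proof (intro sum_mono)
    fix i j
    \<comment> \<open>A square lies above its tangent: \<open>a\<^sup>2 + 2 a (b - a) \<le> b\<^sup>2\<close>.\<close>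
    have "0 \<le> ((norm (Q $ i - Q $ j))\<^sup>2 - (norm (P $ i - P $ j))\<^sup>2)\<^sup>2"
      by simp
    then show "(w i j)\<^sup>2 + 2 * w i j * ((norm (Q $ i - Q $ j))\<^sup>2 - (norm (P $ i - P $ j))\<^sup>2)
        \<le> ((norm (Q $ i - Q $ j))\<^sup>2 - Dbar $ i $ j)\<^sup>2"
      unfolding w_def by (simp add: power2_eq_square algebra_simps)
  qed
  finally show "stress Dbar P \<le> stress Dbar Q"
    by (simp add: stress_sum w_def)
qed

end
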